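(* Fix $\alpha=(\alpha_1,\alpha_2)\in\mathbb{R}^2$. Then there exists a function $f:\mathbb{U}^2\to\mathbb{C}$ such that $f_w\in D_{\alpha_1}$ for all $w\in\mathbb{U}$ and $f_z\in D_{\alpha_2}$ for all $z\in\mathbb{U}$, but $f\notin D_\alpha$.
   Context: $\mathbb{U}$ is the open unit disc in $\mathbb{C}$, $\mathbb{U}^2=\mathbb{U}\times\mathbb{U}$, and $\mathbb{Z}_+$ is the set of nonnegative integers. For $\alpha=(\alpha_1,\alpha_2)\in\mathbb{R}^2$, $D_\alpha$ is the space of functions $f(z,w)=\sum_{(k,l)\in\mathbb{Z}_+^2}a_{k,l}z^kw^l$ on $\mathbb{U}^2$ with $\sum_{(k,l)}|a_{k,l}|^2(k+1)^{\alpha_1}(l+1)^{\alpha_2}<\infty$. For $a\in\mathbb{R}$, $D_a$ is the one-variable space of functions $g(z)=\sum_{k\in\mathbb{Z}_+}b_kz^k$ on $\mathbb{U}$ with $\sum_k|b_k|^2(k+1)^a<\infty$. For $f:\mathbb{U}^2\to\mathbb{C}$ and fixed $w\in\mathbb{U}$, $f_w:\mathbb{U}\to\mathbb{C}$ is the slice in the first variable, $f_w(z)=f(z,w)$; for fixed $z\in\mathbb{U}$, $f_z:\mathbb{U}\to\mathbb{C}$ is the slice in the second variable, $f_z(w)=f(z,w)$. *)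

theory Defs
  imports "HOL-Analysis.Analysis"
begin

abbreviation unit_disc :: "complex set" where
  "unit_disc \<equiv> ball 0 1"

(* A function on the disc (bidisc) is represented by a total function of which only the
   values on the disc (bidisc) matter. The power series are required to converge
   unconditionally, which is automatic for power series on the open disc and, under the
   weighted square summability condition, on the open bidisc. *)

definition Dspace :: "real \<Rightarrow> (complex \<Rightarrow> complex) set" where
  "Dspace a = {g. \<exists>b :: nat \<Rightarrow> complex.
     (\<forall>z\<in>unit_disc. ((\<lambda>k. b k * z ^ k) has_sum g z) UNIV) \<and>
     (\<lambda>k. (norm (b k))\<^sup>2 * (real k + 1) powr a) summable_on UNIV}"

definition Dspace2 :: "real \<times> real \<Rightarrow> (complex \<times> complex \<Rightarrow> complex) set" where
  "Dspace2 \<alpha> = {f. \<exists>a :: nat \<times> nat \<Rightarrow> complex.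
     (\<forall>z\<in>unit_disc. \<forall>w\<in>unit_disc.
        ((\<lambda>(k, l). a (k, l) * z ^ k * w ^ l) has_sum f (z, w)) UNIV) \<and>
     (\<lambda>(k, l). (norm (a (k, l)))\<^sup>2 * (real k + 1) powr fst \<alpha> * (real l + 1) powr snd \<alpha>)
        summable_on UNIV}"

end

theory Submission
  imports Defs "HOL-Real_Asymp.Real_Asymp"
begin

text \<open>
  The counterexample is diagonal: with
  \<open>p = - (\<alpha>\<^sub>1 + \<alpha>\<^sub>2) / 2\<close> put
  \<open>f(z, w) = \<Sum>\<^sub>k (k + 1)\<^sup>p (z w)\<^sup>k\<close>.
  For fixed \<open>w\<close>, the slice \<open>z \<mapsto> f(z, w)\<close> has the coefficients
  \<open>(k + 1)\<^sup>p w\<^sup>k\<close>, which decay geometrically because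
  \<open>w\<close> lies strictly inside the disc; hence the slice belongs to
  every space \<open>D\<^sub>a\<close>, and by symmetry so does every slice in the other variable
  (\<open>diagonal_slice_in_Dspace\<close>). The coefficients of \<open>f\<close> itself
  have no such decay: the exponent \<open>p\<close> is chosen so that every diagonal term
  \<open>\<bar>(k + 1)\<^sup>p\<bar>\<^sup>2 (k + 1)\<^bsup>\<alpha>\<^sub>1 + \<alpha>\<^sub>2\<^esup>\<close>
  of the weighted norm equals \<open>1\<close>.

  Membership of \<open>f\<close> in the two-variable space only asserts that some family of
  coefficients represents \<open>f\<close>, so it also has to be known that \<open>f\<close> determines its
  coefficients. This follows by applying one-variable uniqueness twice, first in \<open>z\<close>
  and then in \<open>w\<close> (\<open>diagonal_double_power_series_coeffs\<close>).
\<close>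

lemma powr_squared: "(x powr p)\<^sup>2 = x powr (2 * p)" for x p :: real
  by (simp only: power2_eq_square mult_2 powr_add)

lemma summable_powr_times_geometric:
  fixes p r :: real
  assumes "0 \<le> r" "r < 1"
  shows "summable (\<lambda>k. (real k + 1) powr p * r ^ k)"
proof (cases "r = 0")
  case True
  then show ?thesis
    using sums_summable[OF powser_sums_zero[of "\<lambda>k. (real k + 1) powr p"]] by simp
next
  case False
  with assms have r: "0 < r" "r < 1" by auto
  have "(\<lambda>k. (real k + 1) powr p * r ^ k) \<in> O(\<lambda>k. 1 / real k ^ 2)"
    using r by real_asymp
  moreover have "summable (\<lambda>k. norm (1 / real k ^ 2))"
    using inverse_power_summable[of 2, where 'a=real] by (simp add: inverse_eq_divide)
  ultimately show ?thesis by (rule summable_comparison_test_bigo[rotated])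
qed

lemma power_series_on_disc_unique:
  fixes a b :: "nat \<Rightarrow> complex"
  assumes a: "\<And>z. z \<in> unit_disc \<Longrightarrow> (\<lambda>k. a k * z ^ k) sums s z"
    and b: "\<And>z. z \<in> unit_disc \<Longrightarrow> (\<lambda>k. b k * z ^ k) sums s z"
  shows "a = b"
proof -
  have radius: "0 < fps_conv_radius (Abs_fps c)"
    if "\<And>z. z \<in> unit_disc \<Longrightarrow> (\<lambda>k. c k * z ^ k) sums s z" for c :: "nat \<Rightarrow> complex"
  proof -
    have "ereal 1 \<le> conv_radius c"
      using that sums_summable by (fastforce simp: le_conv_radius_iff[where \<xi> = 0])
    then show ?thesis
      by (simp add: fps_conv_radius_def less_le_trans[of 0 "ereal 1"])
  qed
  have "eventually (\<lambda>z::complex. z \<in> unit_disc) (nhds 0)"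
    by (rule eventually_nhds_in_open) auto
  then have "eventually (\<lambda>z. eval_fps (Abs_fps a) z = eval_fps (Abs_fps b) z) (nhds 0)"
    by eventually_elim (metis (no_types, lifting) a b eval_fps_def fps_nth_Abs_fps suminf_cong sums_unique)
  then have "Abs_fps a = Abs_fps b"
    by (intro eval_fps_eqD radius a b)
  then show ?thesis
    by (simp add: Abs_fps_inject)
qed

text \<open>
  For fixed \<open>w\<close>, both expansions of \<open>f\<close> are power series in \<open>z\<close>, with \<open>k\<close>th coefficients
  \<open>\<Sum>\<^sub>l a(k, l) w\<^sup>l\<close> and \<open>c k w\<^sup>k\<close>. These agree for every \<open>w\<close>, and comparing
  them as power series in \<open>w\<close> isolates \<open>a(k, l)\<close>.
\<close>

lemma diagonal_double_power_series_coeffs: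
  fixes a :: "nat \<times> nat \<Rightarrow> complex" and c :: "nat \<Rightarrow> complex"
  assumes double: "\<And>z w. z \<in> unit_disc \<Longrightarrow> w \<in> unit_disc \<Longrightarrow>
      ((\<lambda>(k, l). a (k, l) * z ^ k * w ^ l) has_sum f (z, w)) UNIV"
    and diagonal: "\<And>z w. z \<in> unit_disc \<Longrightarrow> w \<in> unit_disc \<Longrightarrow>
      (\<lambda>k. c k * (z * w) ^ k) sums f (z, w)"
  shows "a (k, l) = (if l = k then c k else 0)"
proof -
  define A where "A w k = (\<Sum>\<^sub>\<infinity>l. a (k, l) * w ^ l)" for w k
  have row_summable: "(\<lambda>l. a (k, l) * w ^ l) summable_on UNIV" if w: "w \<in> unit_disc" for w k
  proof -
    \<comment> \<open>Any nonzero point of the disc serves to cancel \<open>z ^ k\<close>.\<close>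
    define z :: complex where "z = 1 / 2"
    have "z \<in> unit_disc" by (simp add: z_def)
    from double[OF this w]
    have "(\<lambda>(k, l). a (k, l) * z ^ k * w ^ l) summable_on (UNIV \<times> UNIV)"
      by (auto simp: summable_on_def)
    then have "(\<lambda>l. a (k, l) * z ^ k * w ^ l) summable_on UNIV"
      by (rule summable_on_SigmaD1) simp
    then have "(\<lambda>l. (1 / z ^ k) * (a (k, l) * z ^ k * w ^ l)) summable_on UNIV"
      by (rule summable_on_cmult_right)
    then show ?thesis
      by (simp add: z_def field_simps)
  qed
  have row_sum: "A w = (\<lambda>k. c k * w ^ k)" if w: "w \<in> unit_disc" for w
  proof (rule power_series_on_disc_unique[where s = "\<lambda>z. f (z, w)"])
    fix z :: complex assume z: "z \<in> unit_disc"
    show "(\<lambda>k. c k * w ^ k * z ^ k) sums f (z, w)"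
      using diagonal[OF z w] by (simp add: power_mult_distrib mult_ac)
    have "((\<lambda>k. A w k * z ^ k) has_sum f (z, w)) UNIV"
    proof (rule has_sum_SigmaD)
      show "((\<lambda>(k, l). a (k, l) * z ^ k * w ^ l) has_sum f (z, w)) (UNIV \<times> UNIV)"
        using double[OF z w] by simp
    next
      fix k
      have "((\<lambda>l. a (k, l) * w ^ l * z ^ k) has_sum A w k * z ^ k) UNIV"
        unfolding A_def by (intro has_sum_cmult_left has_sum_infsum row_summable w)
      then show "((\<lambda>l. case (k, l) of (k, l) \<Rightarrow> a (k, l) * z ^ k * w ^ l)
          has_sum A w k * z ^ k) UNIV"
        by (simp add: mult_ac)
    qed
    then show "(\<lambda>k. A w k * z ^ k) sums f (z, w)"
      by (rule has_sum_imp_sums)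
  qed
  have "(\<lambda>l. a (k, l)) = (\<lambda>l. if l = k then c k else 0)"
  proof (rule power_series_on_disc_unique[where s = "\<lambda>w. c k * w ^ k"])
    fix w :: complex assume w: "w \<in> unit_disc"
    have "((\<lambda>l. a (k, l) * w ^ l) has_sum A w k) UNIV"
      unfolding A_def by (intro has_sum_infsum row_summable w)
    then show "(\<lambda>l. a (k, l) * w ^ l) sums (c k * w ^ k)"
      using row_sum[OF w] by (auto dest: has_sum_imp_sums)
    show "(\<lambda>l. (if l = k then c k else 0) * w ^ l) sums (c k * w ^ k)"
      using sums_single[of k "\<lambda>l. c k * w ^ l"]
      by (simp add: if_distrib[of "\<lambda>x. x * _"] cong: if_cong)
  qed
  then show ?thesis by meson
qed

lemma powr_power_series_has_sum:
  fixes z :: complex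
  assumes "norm z < 1"
  shows "((\<lambda>k. complex_of_real ((real k + 1) powr p) * z ^ k) has_sum
    (\<Sum>k. complex_of_real ((real k + 1) powr p) * z ^ k)) UNIV"
proof -
  have norms: "summable (\<lambda>k. norm (complex_of_real ((real k + 1) powr p) * z ^ k))"
    using summable_powr_times_geometric[of "norm z" p] assms by (simp add: norm_mult norm_power)
  show ?thesis
    by (rule norm_summable_imp_has_sum[OF norms summable_sums[OF summable_norm_cancel[OF norms]]])
qed

text \<open>
  The factor \<open>\<bar>w\<bar>\<^bsup>2k\<^esup>\<close> in the squared coefficients absorbs every power of \<open>k + 1\<close>,
  whatever the exponents \<open>p\<close> and \<open>a\<close> are.
\<close>

lemma diagonal_slice_in_Dspace:
  fixes w :: complex
  assumes w: "w \<in> unit_disc"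
  shows "(\<lambda>z. \<Sum>k. complex_of_real ((real k + 1) powr p) * (z * w) ^ k) \<in> Dspace a"
  unfolding Dspace_def
proof (intro CollectI exI conjI ballI)
  let ?b = "\<lambda>k. complex_of_real ((real k + 1) powr p) * w ^ k"
  fix z :: complex assume z: "z \<in> unit_disc"
  have "norm (z * w) < 1"
    using mult_strict_mono'[of "norm z" 1 "norm w" 1] z w by (simp add: norm_mult)
  from powr_power_series_has_sum[OF this]
  show "((\<lambda>k. ?b k * z ^ k) has_sum
      (\<Sum>k. complex_of_real ((real k + 1) powr p) * (z * w) ^ k)) UNIV"
    by (simp add: power_mult_distrib mult_ac)
next
  let ?b = "\<lambda>k. complex_of_real ((real k + 1) powr p) * w ^ k"
  have "(norm (?b k))\<^sup>2 * (real k + 1) powr a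
      = (real k + 1) powr (2 * p + a) * ((norm w)\<^sup>2) ^ k" for k
    by (simp add: norm_mult norm_power power_mult_distrib powr_add powr_squared mult_ac
        flip: power_mult)
  moreover have "summable (\<lambda>k. (real k + 1) powr (2 * p + a) * ((norm w)\<^sup>2) ^ k)"
    using w by (intro summable_powr_times_geometric) (auto simp: abs_square_less_1)
  ultimately show "(\<lambda>k. (norm (?b k))\<^sup>2 * (real k + 1) powr a) summable_on UNIV"
    by (subst summable_on_UNIV_nonneg_real_iff) auto
qed

theorem theorem4p3:
  fixes \<alpha> :: "real \<times> real"
  shows "\<exists>f :: complex \<times> complex \<Rightarrow> complex.
           (\<forall>w\<in>unit_disc. (\<lambda>z. f (z, w)) \<in> Dspace (fst \<alpha>)) \<and>
           (\<forall>z\<in>unit_disc. (\<lambda>w. f (z, w)) \<in> Dspace (snd \<alpha>)) \<and>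
           f \<notin> Dspace2 \<alpha>"
proof -
  define p where "p = - (fst \<alpha> + snd \<alpha>) / 2"
  define c where "c k = complex_of_real ((real k + 1) powr p)" for k
  define f where "f = (\<lambda>(z, w). \<Sum>k. c k * (z * w) ^ k)"
  have "(\<lambda>z. f (z, w)) \<in> Dspace (fst \<alpha>)" if "w \<in> unit_disc" for w
    using diagonal_slice_in_Dspace[OF that] by (simp add: f_def c_def)
  moreover have "(\<lambda>w. f (z, w)) \<in> Dspace (snd \<alpha>)" if "z \<in> unit_disc" for z
    using diagonal_slice_in_Dspace[OF that] by (simp add: f_def c_def mult.commute[of z])
  moreover have "f \<notin> Dspace2 \<alpha>"
  proof
    assume "f \<in> Dspace2 \<alpha>"
    then obtain a where
      double: "\<And>z w. z \<in> unit_disc \<Longrightarrow> w \<in> unit_disc \<Longrightarrow>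
        ((\<lambda>(k, l). a (k, l) * z ^ k * w ^ l) has_sum f (z, w)) UNIV" and
      weighted: "(\<lambda>(k, l). (norm (a (k, l)))\<^sup>2 * (real k + 1) powr fst \<alpha>
        * (real l + 1) powr snd \<alpha>) summable_on UNIV" (is "?W summable_on _")
      unfolding Dspace2_def by blast
    have diagonal: "(\<lambda>k. c k * (z * w) ^ k) sums f (z, w)"
      if "z \<in> unit_disc" "w \<in> unit_disc" for z w
    proof -
      have "norm (z * w) < 1"
        using mult_strict_mono'[of "norm z" 1 "norm w" 1] that by (simp add: norm_mult)
      then show ?thesis
        using powr_power_series_has_sum by (auto simp: f_def c_def intro: has_sum_imp_sums)
    qed
    have "a (k, k) = c k" for k
      using diagonal_double_power_series_coeffs[OF double diagonal] by simp
    then have "?W (k, k) = (real k + 1) powr (2 * p + fst \<alpha> + snd \<alpha>)" for k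
      by (simp add: c_def powr_add powr_squared)
    moreover have "2 * p + fst \<alpha> + snd \<alpha> = 0"
      by (simp add: p_def field_simps)
    ultimately have diagonal_term: "?W (k, k) = 1" for k
      by simp
    have "?W summable_on range (\<lambda>k. (k, k))"
      using weighted by (rule summable_on_subset_banach) simp
    then have "(?W \<circ> (\<lambda>k. (k, k))) summable_on UNIV"
      by (subst (asm) summable_on_reindex) (auto simp: inj_on_def)
    then have "summable (\<lambda>k::nat. 1 :: real)"
      using diagonal_term by (auto simp: o_def dest: summable_on_imp_summable)
    then show False
      by (simp add: summable_const_iff)
  qed
  ultimately show ?thesis by blast
qed

end
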